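(* Let $c$ be a prefix equivalent statistic and $\theta>0$. Let $\sigma$ and $\tau$ be type I prefixes with $|\sigma|=|\tau|-1=k-1$. Let $\tau'_{k-1}=[1\,2\cdots(k-2)\,k\,(k-1)]$ (a type II prefix of length $k$) and assume $Q^o(\tau'_{k-1})\ge Q(\tau'_{k-1})$. Then if $\tau$ is negative, $\sigma$ is negative.
   Context: Fix $N\ge1$ and $\theta>0$. A prefix is an element of $\bigcup_{k=1}^N S_k$; $|\sigma|$ is its length. For $\pi\in S_N$ and $k\le N$, $\pi|_k\in S_k$ is the permutation order-isomorphic to $(\pi_1,\dots,\pi_k)$. $\pi$ is $\sigma$-prefixed if $\pi|_{|\sigma|}=\sigma$, and $\sigma$-winnable if moreover $\pi_{|\sigma|}=N-1$. A prefix $\sigma$ of length $k$ is of type I if $\sigma_k=k$ and of type II if $\sigma_k=k-1$. For $\tau\in S_k$ and a prefix $\rho$ of length $m\ge k$ with $\rho|_k=[12\cdots k]$, let $g_\tau\cdot\rho=(\rho_{\tau_1},\dots,\rho_{\tau_k},\rho_{k+1},\dots,\rho_m)$. A statistic $c:\bigcup_{i=1}^N S_i\to\mathbb{Z}_{\ge0}$ is prefix equivalent if $c(\rho)-c(g_\tau\cdot\rho)=c([12\cdots k])-c(\tau)$ for all $k$, all $\tau\in S_k$ and all such $\rho$ (e.g. the number of inversions). The interview order $\pi\in S_N$ is random with $P(\pi)\propto\theta^{c(\pi)}$; at time $i$ a strategy sees only $\pi|_i$ and accepts or rejects irrevocably, winning if the accepted value is $N-1$. For a prefix $\sigma$: $Q(\sigma)=\sum_{\sigma\text{-winnable}\,\pi}\theta^{c(\pi)}/\sum_{\sigma\text{-prefixed}\,\pi}\theta^{c(\pi)}$;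 $Q^o(\sigma)$ is the maximal conditional probability, given $\pi$ is $\sigma$-prefixed, of winning with a strategy that rejects candidate $|\sigma|$ and all earlier ones ($Q^o(\sigma)=0$ if $|\sigma|=N$). $\sigma$ is positive if $Q(\sigma)\ge Q^o(\sigma)$ and negative otherwise. *)

theory Defs
  imports "HOL-Probability.Probability" "HOL-Combinatorics.Multiset_Permutations"
begin

(* Permutations in one-line notation; positions and values start at 1, list indices at 0. *)
abbreviation perms :: "nat \<Rightarrow> nat list set" where
  "perms k \<equiv> permutations_of_set {1..k}"

definition prefixes :: "nat \<Rightarrow> nat list set" where
  "prefixes N = (\<Union>k\<in>{1..N}. perms k)"

definition id_perm :: "nat \<Rightarrow> nat list" where
  "id_perm k = [1..<Suc k]"

definition standardize :: "nat list \<Rightarrow> nat list" where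
  "standardize xs = map (\<lambda>x. card {y \<in> set xs. y \<le> x}) xs"

definition restr :: "nat \<Rightarrow> nat list \<Rightarrow> nat list" where
  "restr k \<pi> = standardize (take k \<pi>)"

lemma card_le_strict_mono:
  fixes x y :: nat
  assumes "finite A" "y \<in> A" "x < y"
  shows "card {z \<in> A. z \<le> x} < card {z \<in> A. z \<le> y}"
proof (rule psubset_card_mono)
  have "y \<in> {z \<in> A. z \<le> y}" "y \<notin> {z \<in> A. z \<le> x}" using assms by auto
  moreover have "{z \<in> A. z \<le> x} \<subseteq> {z \<in> A. z \<le> y}" using assms by auto
  ultimately show "{z \<in> A. z \<le> x} \<subset> {z \<in> A. z \<le> y}" by blast
qed (use assms in auto)

lemma standardize_in_perms:
  assumes "distinct xs"
  shows "standardize xs \<in> perms (length xs)"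
proof -
  let ?r = "\<lambda>x. card {y \<in> set xs. y \<le> x}"
  have mono: "?r x < ?r y" if "x \<in> set xs" "y \<in> set xs" "x < y" for x y
    using that by (intro card_le_strict_mono) auto
  then have inj: "inj_on ?r (set xs)"
    by (intro linorder_inj_onI') (auto dest: less_imp_neq)
  have "?r x \<in> {1..length xs}" if "x \<in> set xs" for x
  proof -
    have "?r x > 0" using that by (auto simp: card_gt_0_iff)
    moreover have "?r x \<le> card (set xs)" by (rule card_mono) auto
    ultimately show ?thesis using distinct_card[OF assms] by (simp only: atLeastAtMost_iff One_nat_def Suc_le_eq)
  qed
  then have "?r ` set xs \<subseteq> {1..length xs}" by blast
  moreover have "card (?r ` set xs) = length xs"
    using card_image[OF inj] distinct_card[OF assms] by simp
  ultimately have "?r ` set xs = {1..length xs}"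
    by (intro card_subset_eq) auto
  then show ?thesis
    using inj assms by (auto simp: permutations_of_set_def standardize_def distinct_map)
qed

lemma standardize_order_isomorphic:
  assumes "i < length xs" "j < length xs"
  shows "standardize xs ! i < standardize xs ! j \<longleftrightarrow> xs ! i < xs ! j"
proof -
  let ?r = "\<lambda>x. card {y \<in> set xs. y \<le> x}"
  have "?r x < ?r y" if "x \<in> set xs" "y \<in> set xs" "x < y" for x y
    using that by (intro card_le_strict_mono) auto
  then have "?r (xs ! i) < ?r (xs ! j)" if "xs ! i < xs ! j"
    using that assms by simp
  moreover have "\<not> ?r (xs ! i) < ?r (xs ! j)" if "\<not> xs ! i < xs ! j"
    unfolding not_less by (rule card_mono) (use that in auto)
  ultimately show ?thesis
    using assms unfolding standardize_def by (simp only: nth_map) blast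
qed

definition prefixed :: "nat \<Rightarrow> nat list \<Rightarrow> nat list \<Rightarrow> bool" where
  "prefixed N \<sigma> \<pi> \<longleftrightarrow> \<pi> \<in> perms N \<and> restr (length \<sigma>) \<pi> = \<sigma>"

definition winnable :: "nat \<Rightarrow> nat list \<Rightarrow> nat list \<Rightarrow> bool" where
  "winnable N \<sigma> \<pi> \<longleftrightarrow> prefixed N \<sigma> \<pi> \<and> \<pi> ! (length \<sigma> - 1) = N - 1"

definition type_I :: "nat \<Rightarrow> nat list \<Rightarrow> bool" where
  "type_I N \<sigma> \<longleftrightarrow> \<sigma> \<in> prefixes N \<and> \<sigma> ! (length \<sigma> - 1) = length \<sigma>"

definition act :: "nat list \<Rightarrow> nat list \<Rightarrow> nat list" where
  "act \<tau> \<rho> = map (\<lambda>i. \<rho> ! (i - 1)) \<tau> @ drop (length \<tau>) \<rho>"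

definition prefix_equivalent :: "nat \<Rightarrow> (nat list \<Rightarrow> nat) \<Rightarrow> bool" where
  "prefix_equivalent N c \<longleftrightarrow>
     (\<forall>k\<in>{1..N}. \<forall>\<tau>\<in>perms k. \<forall>\<rho>\<in>prefixes N.
        k \<le> length \<rho> \<and> restr k \<rho> = id_perm k \<longrightarrow>
        int (c \<rho>) - int (c (act \<tau> \<rho>)) = int (c (id_perm k)) - int (c \<tau>))"

definition interview_pmf :: "nat \<Rightarrow> real \<Rightarrow> (nat list \<Rightarrow> nat) \<Rightarrow> nat list pmf" where
  "interview_pmf N \<theta> c =
     embed_pmf (\<lambda>\<pi>. if \<pi> \<in> perms N then \<theta> ^ c \<pi> / (\<Sum>\<pi>'\<in>perms N. \<theta> ^ c \<pi>') else 0)"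

lemma pmf_interview_pmf:
  assumes "\<theta> > 0"
  shows "pmf (interview_pmf N \<theta> c) \<pi> =
    (if \<pi> \<in> perms N then \<theta> ^ c \<pi> / (\<Sum>\<pi>'\<in>perms N. \<theta> ^ c \<pi>') else 0)"
  unfolding interview_pmf_def
proof (rule pmf_embed_pmf)
  let ?Z = "\<Sum>\<pi>'\<in>perms N. \<theta> ^ c \<pi>'"
  let ?f = "\<lambda>\<pi>. if \<pi> \<in> perms N then \<theta> ^ c \<pi> / ?Z else 0"
  have ne: "perms N \<noteq> {}" by (simp add: permutations_of_set_empty_iff)
  have Z: "?Z > 0" using ne assms by (intro sum_pos) auto
  show nonneg: "0 \<le> ?f \<pi>" for \<pi> using Z assms by simp
  have "(\<integral>\<^sup>+\<pi>. ennreal (?f \<pi>) \<partial>count_space UNIV) = (\<Sum>\<pi>\<in>perms N. ennreal (?f \<pi>))"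
    by (rule nn_integral_count_space') auto
  also have "\<dots> = ennreal (\<Sum>\<pi>\<in>perms N. ?f \<pi>)"
    by (rule sum_ennreal[of _ ?f]) (rule nonneg)
  also have "(\<Sum>\<pi>\<in>perms N. ?f \<pi>) = 1"
    using Z by (simp add: sum_divide_distrib[symmetric])
  finally show "(\<integral>\<^sup>+\<pi>. ennreal (?f \<pi>) \<partial>count_space UNIV) = 1" by simp
qed

definition Q :: "nat \<Rightarrow> real \<Rightarrow> (nat list \<Rightarrow> nat) \<Rightarrow> nat list \<Rightarrow> real" where
  "Q N \<theta> c \<sigma> =
     (\<Sum>\<pi> | winnable N \<sigma> \<pi>. \<theta> ^ c \<pi>) / (\<Sum>\<pi> | prefixed N \<sigma> \<pi>. \<theta> ^ c \<pi>)"

(* A strategy is the set A of prefixes on which it accepts: it stops at the first time i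
   with restr i \<pi> in A, and never accepts if there is no such time. Until it stops it has
   rejected every candidate, so restr i \<pi> carries all the information available at time i. *)
definition wins :: "nat \<Rightarrow> nat list set \<Rightarrow> nat list \<Rightarrow> bool" where
  "wins N A \<pi> \<longleftrightarrow>
     (\<exists>i\<in>{1..N}. restr i \<pi> \<in> A \<and> (\<forall>j\<in>{1..<i}. restr j \<pi> \<notin> A) \<and> \<pi> ! (i - 1) = N - 1)"

(* On every \<sigma>-prefixed \<pi>, these are the strategies that reject candidates 1, ..., |\<sigma>|. *)
definition rejecting_strategies :: "nat \<Rightarrow> nat list \<Rightarrow> nat list set set" where
  "rejecting_strategies N \<sigma> =
     {A. A \<subseteq> prefixes N \<and> (\<forall>i\<in>{1..length \<sigma>}. restr i \<sigma> \<notin> A)}"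

(* The maximum is over a finite nonempty set, since prefixes N is finite. *)
definition Qo :: "nat \<Rightarrow> real \<Rightarrow> (nat list \<Rightarrow> nat) \<Rightarrow> nat list \<Rightarrow> real" where
  "Qo N \<theta> c \<sigma> =
     (if length \<sigma> = N then 0
      else MAX A\<in>rejecting_strategies N \<sigma>.
             \<P>(\<pi> in measure_pmf (interview_pmf N \<theta> c). wins N A \<pi> \<bar> prefixed N \<sigma> \<pi>))"

definition positive :: "nat \<Rightarrow> real \<Rightarrow> (nat list \<Rightarrow> nat) \<Rightarrow> nat list \<Rightarrow> bool" where
  "positive N \<theta> c \<sigma> \<longleftrightarrow> Q N \<theta> c \<sigma> \<ge> Qo N \<theta> c \<sigma>"

definition negative :: "nat \<Rightarrow> real \<Rightarrow> (nat list \<Rightarrow> nat) \<Rightarrow> nat list \<Rightarrow> bool" where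
  "negative N \<theta> c \<sigma> \<longleftrightarrow> \<not> positive N \<theta> c \<sigma>"

end

theory Submission
  imports Defs
begin

text \<open>Rearranging the first \<open>k\<close> entries of an interview order into another relative order
multiplies all weights by a common factor, because \<open>c\<close> is prefix equivalent. Hence an event that
does not depend on the relative order of the first \<open>k\<close> candidates has the same conditional
probability given any prefix of length \<open>k\<close>, and given any shorter prefix as well. Strategies that
reject the first \<open>k\<close> candidates can be transported along such rearrangements, so \<open>Qo \<tau> \<le> Qo \<sigma>\<close>
whenever \<open>length \<sigma> \<le> length \<tau> < N\<close>.

Let now \<open>\<sigma>\<close> be of type I and length \<open>k - 1\<close>. Its last entry stays the largest of the first \<open>k\<close>
unless the next candidate exceeds it, in which case it becomes the second largest. By the invariance,
\<open>Q \<sigma>\<close> is therefore a convex combination of \<open>Q \<tau>\<close> and \<open>Q \<tau>'\<close> in which \<open>Q \<tau>\<close> has positive weight.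
Since \<open>Q \<tau> < Qo \<tau> \<le> Qo \<sigma>\<close> and \<open>Q \<tau>' \<le> Qo \<tau>' \<le> Qo \<sigma>\<close>, this gives \<open>Q \<sigma> < Qo \<sigma>\<close>.\<close>

section \<open>Standardization and restriction of lists\<close>

lemma standardize_map_strict_mono:
  assumes "\<And>x y. x \<in> set xs \<Longrightarrow> y \<in> set xs \<Longrightarrow> x < y \<Longrightarrow> f x < f y"
  shows "standardize (map f xs) = standardize xs"
proof -
  have le: "f x \<le> f y \<longleftrightarrow> x \<le> y" if "x \<in> set xs" "y \<in> set xs" for x y
    using assms[of x y] assms[of y x] that by (metis leD leI le_less)
  have inj: "inj_on f (set xs)"
    using assms by (intro linorder_inj_onI') (auto dest: less_imp_neq)
  have "card {y \<in> f ` set xs. y \<le> f x} = card {y \<in> set xs. y \<le> x}" if "x \<in> set xs" for x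
  proof -
    have "{y \<in> f ` set xs. y \<le> f x} = f ` {y \<in> set xs. y \<le> x}"
      using le that by auto
    then show ?thesis
      using inj by (simp add: card_image inj_on_subset)
  qed
  then show ?thesis by (simp add: standardize_def)
qed

lemma length_standardize [simp]: "length (standardize xs) = length xs"
  by (simp add: standardize_def)

lemma length_restr: "length (restr i xs) = min (length xs) i"
  by (simp add: restr_def)

lemma permsD:
  assumes "\<tau> \<in> perms k"
  shows "set \<tau> = {1..k}" "distinct \<tau>" "length \<tau> = k"
  using assms by (auto simp: permutations_of_set_def dest: distinct_card)

lemma perms_nth:
  assumes "\<tau> \<in> perms k" "j < k"
  shows "1 \<le> \<tau> ! j" "\<tau> ! j \<le> k"
  using permsD[OF assms(1)] assms(2) nth_mem[of j \<tau>] by auto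

lemma id_perm_in_perms: "id_perm k \<in> perms k"
  by (auto simp: permutations_of_set_def id_perm_def)

lemma standardize_perms:
  assumes "\<tau> \<in> perms k"
  shows "standardize \<tau> = \<tau>"
proof -
  have "{y. (1 \<le> y \<and> y \<le> k) \<and> y \<le> x} = {1..x}" if "x \<le> k" for x
    using that by auto
  then show ?thesis
    using permsD[OF assms] by (auto simp: standardize_def intro!: map_idI)
qed

text \<open>Within the first \<open>k\<close> entries the rank is a strictly increasing function of
  the entry, so replacing entries by ranks leaves the relative order of the first \<open>m\<close>
  intact.\<close>

lemma restr_restr:
  assumes "m \<le> k"
  shows "restr m (restr k xs) = restr m xs"
proof -
  let ?r = "\<lambda>x. card {y \<in> set (take k xs). y \<le> x}"
  have "take m (standardize (take k xs)) = map ?r (take m xs)"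
    using assms by (simp add: standardize_def take_map min_absorb1)
  moreover have "standardize (map ?r (take m xs)) = standardize (take m xs)"
    using assms set_take_subset_set_take[of m k xs]
    by (intro standardize_map_strict_mono card_le_strict_mono) auto
  ultimately show ?thesis by (simp add: restr_def)
qed

lemma sort_map_mono:
  assumes "mono f"
  shows "sort (map f xs) = map f (sort xs)"
proof (rule properties_for_sort)
  have "sorted (sort xs)" by simp
  then show "sorted (map f (sort xs))"
    using assms by (auto simp: sorted_iff_nth_mono monoD)
qed simp

text \<open>In a strictly sorted list the entries not exceeding the one at index \<open>p\<close>
  sit at the indices \<open>0\<close> to \<open>p\<close>. There are \<open>Suc p\<close> of them,
  so subtracting 1 from the rank gives back the index. This allows a list to be split into its
  relative order and its set of values.\<close>

lemma standardize_nth: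
  assumes "distinct xs" "j < length xs"
  shows "sort xs ! (standardize xs ! j - 1) = xs ! j"
proof -
  have "xs ! j \<in> set (sort xs)" using assms by simp
  then obtain p where p: "p < length xs" "sort xs ! p = xs ! j"
    by (metis in_set_conv_nth length_sort)
  have sm: "sort xs ! a \<le> sort xs ! b \<longleftrightarrow> a \<le> b" if "a < length xs" "b < length xs" for a b
  proof -
    have "sorted_wrt (<) (sort xs)" using assms by (simp add: strict_sorted_iff)
    from sorted_wrt_nth_less[OF this, of b a] show ?thesis
      using that sorted_nth_mono[of "sort xs" a b] by (auto simp: not_less[symmetric])
  qed
  have "{y \<in> set xs. y \<le> xs ! j} = (\<lambda>a. sort xs ! a) ` {..p}"
  proof -
    have "set ys = (\<lambda>a. ys ! a) ` {..<length ys}" for ys :: "nat list"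
      by (auto simp: set_conv_nth)
    from this[of "sort xs"] have "set xs = (\<lambda>a. sort xs ! a) ` {..<length xs}"
      by simp
    then have "{y \<in> set xs. y \<le> xs ! j} = (\<lambda>a. sort xs ! a) ` {a \<in> {..<length xs}. sort xs ! a \<le> sort xs ! p}"
      using p by auto
    also have "{a \<in> {..<length xs}. sort xs ! a \<le> sort xs ! p} = {a \<in> {..<length xs}. a \<le> p}"
      using sm[OF _ p(1)] by blast
    also have "\<dots> = {..p}"
      using p(1) by auto
    finally show ?thesis .
  qed
  moreover have "inj_on (\<lambda>a. sort xs ! a) {..p}"
    using p assms by (intro inj_onI) (auto simp: nth_eq_iff_index_eq)
  ultimately have "standardize xs ! j = Suc p"
    using assms by (simp add: standardize_def card_image)
  then show ?thesis using p by simp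
qed

section \<open>Rearranging the first entries\<close>

text \<open>In the notation of the group action, \<open>reord \<tau> \<rho> = g\<^sub>\<tau> \<cdot> g\<^sub>\<eta>\<^sup>-\<^sup>1 \<cdot> \<rho>\<close> for the prefix \<open>\<eta>\<close>
of \<open>\<rho>\<close> of the same length as \<open>\<tau>\<close>.\<close>
definition reord :: "nat list \<Rightarrow> nat list \<Rightarrow> nat list" where
  "reord \<tau> \<rho> = map (\<lambda>i. sort (take (length \<tau>) \<rho>) ! (i - 1)) \<tau> @ drop (length \<tau>) \<rho>"

lemma length_reord [simp]: "length \<tau> \<le> length \<rho> \<Longrightarrow> length (reord \<tau> \<rho>) = length \<rho>"
  by (simp add: reord_def)

lemma mset_map_nth_perms:
  assumes "\<tau> \<in> perms (length s)"
  shows "mset (map (\<lambda>i. s ! (i - 1)) \<tau>) = mset s"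
proof -
  have "mset \<tau> = mset (id_perm (length s))"
    using permsD[OF assms] permsD[OF id_perm_in_perms] by (metis set_eq_iff_mset_eq_distinct)
  then have "mset (map (\<lambda>i. s ! (i - 1)) \<tau>) = mset (map (\<lambda>i. s ! (i - 1)) (id_perm (length s)))"
    by (simp only: mset_map)
  also have "map (\<lambda>i. s ! (i - 1)) (id_perm (length s)) = s"
    by (auto simp: id_perm_def intro!: nth_equalityI simp del: upt_Suc)
  finally show ?thesis .
qed

lemma mset_take_reord:
  assumes "\<tau> \<in> perms k" "k \<le> length \<rho>"
  shows "mset (take k (reord \<tau> \<rho>)) = mset (take k \<rho>)"
  using mset_map_nth_perms[of \<tau> "sort (take k \<rho>)"] assms permsD(3)[OF assms(1)]
  by (simp add: reord_def min_absorb2)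

lemma drop_reord:
  assumes "length \<tau> = k"
  shows "drop k (reord \<tau> \<rho>) = drop k \<rho>"
  using assms by (simp add: reord_def)

lemma mset_reord:
  assumes "\<tau> \<in> perms k" "k \<le> length \<rho>"
  shows "mset (reord \<tau> \<rho>) = mset \<rho>"
  using mset_take_reord[OF assms] drop_reord[OF permsD(3)[OF assms(1)], of \<rho>]
  by (metis append_take_drop_id mset_append)

lemma sort_take_reord:
  assumes "\<tau> \<in> perms k" "k \<le> length \<rho>"
  shows "sort (take k (reord \<tau> \<rho>)) = sort (take k \<rho>)"
  using mset_take_reord[OF assms] by (metis mset_sort properties_for_sort sorted_sort)

text \<open>The outer \<open>reord\<close> reads only the sorted first \<open>k\<close> entries and
  the tail, and the inner one changes neither. This makes rearrangements to two different relative
  orders mutually inverse on the corresponding sets of prefixed permutations.\<close>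

lemma reord_reord:
  assumes "\<tau> \<in> perms k" "\<eta> \<in> perms k" "k \<le> length \<rho>"
  shows "reord \<tau> (reord \<eta> \<rho>) = reord \<tau> \<rho>"
  using sort_take_reord[OF assms(2,3)] drop_reord[OF permsD(3)[OF assms(2)], of \<rho>]
    permsD(3)[OF assms(1)]
  by (simp add: reord_def[of \<tau>])

lemma restr_reord_eq:
  assumes "\<tau> \<in> perms k" "k \<le> length \<rho>" "distinct \<rho>"
  shows "restr k (reord \<tau> \<rho>) = \<tau>"
proof -
  let ?s = "sort (take k \<rho>)"
  have s: "sorted_wrt (<) ?s" "length ?s = k"
    using assms by (auto simp: strict_sorted_iff min_absorb2)
  have "take k (reord \<tau> \<rho>) = map (\<lambda>i. ?s ! (i - 1)) \<tau>"
    using permsD[OF assms(1)] by (simp add: reord_def)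
  moreover have "standardize (map (\<lambda>i. ?s ! (i - 1)) \<tau>) = standardize \<tau>"
    using permsD[OF assms(1)] s
    by (intro standardize_map_strict_mono sorted_wrt_nth_less[OF s(1)]) auto
  ultimately show ?thesis
    using standardize_perms[OF assms(1)] by (simp add: restr_def)
qed

lemma reord_restr_self:
  assumes "k \<le> length \<rho>" "distinct \<rho>"
  shows "reord (restr k \<rho>) \<rho> = \<rho>"
proof -
  have "map (\<lambda>i. sort (take k \<rho>) ! (i - 1)) (standardize (take k \<rho>)) = take k \<rho>"
    using assms by (intro nth_equalityI) (auto simp: standardize_nth[where xs = "take k \<rho>", simplified])
  then show ?thesis using assms by (simp add: reord_def restr_def min_absorb2)
qed

text \<open>The rank function depends only on the set of entries, which rearranging preserves, and
  being monotone it commutes with sorting.\<close>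

lemma standardize_reord:
  assumes "\<tau> \<in> perms k" "k \<le> length xs"
  shows "standardize (reord \<tau> xs) = reord \<tau> (standardize xs)"
proof -
  let ?r = "\<lambda>x. card {y \<in> set xs. y \<le> x}"
  have "set (reord \<tau> xs) = set xs"
    using mset_reord[OF assms] by (metis set_mset_mset)
  then have "standardize (reord \<tau> xs) = map ?r (reord \<tau> xs)"
    by (simp add: standardize_def)
  also have "\<dots> = reord \<tau> (map ?r xs)"
  proof -
    have "mono ?r" by (intro monoI card_mono) auto
    then have "sort (take k (map ?r xs)) = map ?r (sort (take k xs))"
      by (simp add: take_map sort_map_mono)
    then show ?thesis
      using permsD[OF assms(1)] assms(2) by (auto simp: reord_def drop_map)
  qed
  finally show ?thesis by (simp add: standardize_def)
qed

text \<open>From time \<open>k\<close> on, what an observer of the rearranged order sees can be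
  computed from what an observer of the original order sees. Strategies can therefore be carried
  over.\<close>

lemma restr_reord:
  assumes "\<tau> \<in> perms k" "k \<le> i" "i \<le> length \<rho>"
  shows "restr i (reord \<tau> \<rho>) = reord \<tau> (restr i \<rho>)"
proof -
  have "take i (reord \<tau> \<rho>) = reord \<tau> (take i \<rho>)"
    using assms permsD[OF assms(1)] by (simp add: reord_def min_absorb1 drop_take)
  then show ?thesis
    using standardize_reord[of \<tau> k "take i \<rho>"] assms by (simp add: restr_def)
qed

lemma reord_in_perms:
  assumes "\<tau> \<in> perms k" "k \<le> N" "\<pi> \<in> perms N"
  shows "reord \<tau> \<pi> \<in> perms N"
proof -
  have "mset (reord \<tau> \<pi>) = mset \<pi>"
    using mset_reord[OF assms(1)] permsD[OF assms(3)] assms(2) by simp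
  then show ?thesis
    using assms(3) unfolding permutations_of_set_def
    by (metis (mono_tags, lifting) mem_Collect_eq mset_eq_imp_distinct_iff set_mset_mset)
qed

lemma prefixed_reord:
  assumes "\<tau> \<in> perms k" "k \<le> N" "\<pi> \<in> perms N"
  shows "prefixed N \<tau> (reord \<tau> \<pi>)"
  using restr_reord_eq[OF assms(1), of \<pi>] permsD[OF assms(3)] permsD[OF assms(1)]
    reord_in_perms[OF assms] assms(2)
  by (simp add: prefixed_def)

lemma reord_prefixed:
  assumes "prefixed N \<tau> \<pi>" "length \<tau> \<le> N"
  shows "reord \<tau> \<pi> = \<pi>"
  using assms permsD[of \<pi> N] reord_restr_self[of "length \<tau>" \<pi>] by (auto simp: prefixed_def)

lemma restr_in_perms:
  assumes "\<pi> \<in> perms N" "k \<le> N"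
  shows "restr k \<pi> \<in> perms k"
  using standardize_in_perms[of "take k \<pi>"] permsD[OF assms(1)] assms(2)
  by (simp add: restr_def min_absorb2)

text \<open>Rearranging by \<open>id_perm k\<close> sorts the first \<open>k\<close> entries, which
  is the form in which \<open>prefix_equivalent\<close> applies. Every \<open>reord\<close> thus
  becomes a group action on such a sorted list.\<close>

lemma act_reord_id:
  assumes "\<tau> \<in> perms k" "k \<le> length \<rho>"
  shows "act \<tau> (reord (id_perm k) \<rho>) = reord \<tau> \<rho>"
proof -
  have l: "length \<tau> = k" "length (id_perm k) = k"
    using permsD(3)[OF assms(1)] by (auto simp: id_perm_def)
  have "reord (id_perm k) \<rho> ! (i - 1) = sort (take k \<rho>) ! (i - 1)" if "i \<in> set \<tau>" for i
    using that permsD(1)[OF assms(1)] l assms(2)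
    by (auto simp: reord_def nth_append id_perm_def simp del: upt_Suc)
  then show ?thesis
    using l drop_reord[OF l(2)] by (simp add: act_def reord_def[of \<tau>])
qed

section \<open>Weights of events and their invariance\<close>

definition weight :: "real \<Rightarrow> (nat list \<Rightarrow> nat) \<Rightarrow> nat list set \<Rightarrow> real" where
  "weight \<theta> c S = (\<Sum>\<pi>\<in>S. \<theta> ^ c \<pi>)"

text \<open>These are the events that depend only on the set of the first \<open>k\<close> values
  and on the later entries.\<close>

definition reord_invariant :: "nat \<Rightarrow> nat \<Rightarrow> (nat list \<Rightarrow> bool) \<Rightarrow> bool" where
  "reord_invariant N k f \<longleftrightarrow> (\<forall>\<tau>\<in>perms k. \<forall>\<pi>\<in>perms N. f (reord \<tau> \<pi>) \<longleftrightarrow> f \<pi>)"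

lemma finite_prefixed [simp]: "finite {\<pi>. prefixed N \<sigma> \<pi>}"
  by (rule finite_subset[of _ "perms N"]) (auto simp: prefixed_def)

lemma weight_pos:
  assumes "\<theta> > 0" "finite S" "S \<noteq> {}"
  shows "weight \<theta> c S > 0"
  using assms unfolding weight_def by (intro sum_pos) auto

lemma weight_prefixed_pos:
  assumes "\<theta> > 0" "\<tau> \<in> perms k" "k \<le> N"
  shows "weight \<theta> c {\<pi>. prefixed N \<tau> \<pi>} > 0"
  using prefixed_reord[OF assms(2,3) id_perm_in_perms] assms(1) by (intro weight_pos) auto

lemma Q_weight: "Q N \<theta> c \<sigma> = weight \<theta> c {\<pi>. winnable N \<sigma> \<pi>} / weight \<theta> c {\<pi>. prefixed N \<sigma> \<pi>}"
  by (simp add: Q_def weight_def)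

text \<open>The normalizing constant of the distribution cancels in the quotient.\<close>

lemma cond_prob_weight:
  assumes "\<theta> > 0"
  shows "\<P>(\<pi> in measure_pmf (interview_pmf N \<theta> c). f \<pi> \<bar> prefixed N \<sigma> \<pi>)
    = weight \<theta> c {\<pi>. prefixed N \<sigma> \<pi> \<and> f \<pi>} / weight \<theta> c {\<pi>. prefixed N \<sigma> \<pi>}"
proof -
  let ?Z = "weight \<theta> c (perms N)"
  have ne: "perms N \<noteq> {}" using id_perm_in_perms by blast
  have Z: "?Z > 0" using ne assms by (intro weight_pos) auto
  have *: "measure (measure_pmf (interview_pmf N \<theta> c)) S = weight \<theta> c S / ?Z"
    if "S \<subseteq> perms N" for S
    using that finite_subset[OF that]
    by (auto simp: measure_measure_pmf_finite pmf_interview_pmf[OF assms] weight_def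
        sum_divide_distrib intro!: sum.cong)
  have "{\<pi>. f \<pi> \<and> prefixed N \<sigma> \<pi>} \<subseteq> perms N" "{\<pi>. prefixed N \<sigma> \<pi>} \<subseteq> perms N"
    by (auto simp: prefixed_def)
  from this[THEN *] show ?thesis
    using Z by (simp add: cond_prob_def conj_commute)
qed

text \<open>Sorting the first \<open>k\<close> entries is a bijection between the two events with
  inverse \<open>reord \<tau>\<close>, and prefix equivalence makes the ratio of weights the same
  for all matched pairs. The ratio is stated cross-multiplied.\<close>

lemma weight_reord_invariant:
  assumes "\<theta> > 0" "prefix_equivalent N c" "reord_invariant N k f"
    and "\<tau> \<in> perms k" "1 \<le> k" "k \<le> N"
  shows "weight \<theta> c {\<pi>. prefixed N \<tau> \<pi> \<and> f \<pi>} * \<theta> ^ c (id_perm k)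
       = weight \<theta> c {\<pi>. prefixed N (id_perm k) \<pi> \<and> f \<pi>} * \<theta> ^ c \<tau>"
proof -
  note id = id_perm_in_perms[of k]
  note lt = permsD(3)[OF assms(4)] permsD(3)[OF id]
  have bij: "(\<Sum>\<pi> | prefixed N \<tau> \<pi> \<and> f \<pi>. \<theta> ^ c \<pi> * \<theta> ^ c (id_perm k))
      = (\<Sum>\<pi> | prefixed N (id_perm k) \<pi> \<and> f \<pi>. \<theta> ^ c \<pi> * \<theta> ^ c \<tau>)"
  proof (rule sum.reindex_bij_witness[where i = "reord \<tau>" and j = "reord (id_perm k)"])
    fix \<pi> assume "\<pi> \<in> {\<pi>. prefixed N \<tau> \<pi> \<and> f \<pi>}"
    then have \<pi>: "prefixed N \<tau> \<pi>" "f \<pi>" "\<pi> \<in> perms N" by (auto simp: prefixed_def)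
    have len: "k \<le> length \<pi>" using permsD[OF \<pi>(3)] assms by simp
    let ?\<rho> = "reord (id_perm k) \<pi>"
    show "reord \<tau> ?\<rho> = \<pi>"
      using reord_reord[OF assms(4) id len] reord_prefixed[OF \<pi>(1)] lt assms by simp
    have pre: "prefixed N (id_perm k) ?\<rho>"
      using prefixed_reord[OF id assms(6) \<pi>(3)] .
    then show "?\<rho> \<in> {\<pi>. prefixed N (id_perm k) \<pi> \<and> f \<pi>}"
      using assms(3) id \<pi> by (auto simp: reord_invariant_def)
    have "act \<tau> ?\<rho> = \<pi>"
      using act_reord_id[OF assms(4) len] reord_prefixed[OF \<pi>(1)] lt assms by simp
    moreover have "?\<rho> \<in> prefixes N" "k \<le> length ?\<rho>" "restr k ?\<rho> = id_perm k"
      using pre assms permsD[of ?\<rho> N] lt by (auto simp: prefixes_def prefixed_def)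
    ultimately have "int (c ?\<rho>) - int (c \<pi>) = int (c (id_perm k)) - int (c \<tau>)"
      using assms(2,4-6) unfolding prefix_equivalent_def by (metis atLeastAtMost_iff)
    \<comment> \<open>Moving the subtracted terms across gives an identity of natural
      exponents.\<close>
    then have "c ?\<rho> + c \<tau> = c \<pi> + c (id_perm k)" by linarith
    then show "\<theta> ^ c ?\<rho> * \<theta> ^ c \<tau> = \<theta> ^ c \<pi> * \<theta> ^ c (id_perm k)"
      by (simp flip: power_add)
  next
    fix \<pi> assume "\<pi> \<in> {\<pi>. prefixed N (id_perm k) \<pi> \<and> f \<pi>}"
    then have \<pi>: "prefixed N (id_perm k) \<pi>" "f \<pi>" "\<pi> \<in> perms N" by (auto simp: prefixed_def)
    have len: "k \<le> length \<pi>" using permsD[OF \<pi>(3)] assms by simp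
    show "reord (id_perm k) (reord \<tau> \<pi>) = \<pi>"
      using reord_reord[OF id assms(4) len] reord_prefixed[OF \<pi>(1)] lt assms by simp
    show "reord \<tau> \<pi> \<in> {\<pi>. prefixed N \<tau> \<pi> \<and> f \<pi>}"
      using prefixed_reord[OF assms(4,6) \<pi>(3)] assms(3,4) \<pi> by (auto simp: reord_invariant_def)
  qed
  then show ?thesis by (simp add: weight_def sum_distrib_right)
qed

text \<open>Summing over the relative orders in \<open>S\<close>, each block is
  \<open>C \<eta>\<close> times the block of \<open>id_perm k\<close>, with and without the
  condition \<open>f\<close>. The common factor \<open>sum C S\<close> cancels, so the conditional
  probability of \<open>f\<close> is the same for every \<open>S\<close> of positive weight as for
  the single prefix \<open>\<tau>\<close>.\<close>

lemma weight_invariant_proportional: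
  assumes "\<theta> > 0" "prefix_equivalent N c" "reord_invariant N k f"
    and "\<tau> \<in> perms k" "1 \<le> k" "k \<le> N"
    and "S \<subseteq> perms k"
  shows "weight \<theta> c {\<pi> \<in> perms N. restr k \<pi> \<in> S \<and> f \<pi>}
       = weight \<theta> c {\<pi>. prefixed N \<tau> \<pi> \<and> f \<pi>} / weight \<theta> c {\<pi>. prefixed N \<tau> \<pi>}
         * weight \<theta> c {\<pi> \<in> perms N. restr k \<pi> \<in> S}"
proof -
  let ?w = "weight \<theta> c" and ?i = "id_perm k"
  have inv_True: "reord_invariant N k (\<lambda>_. True)" by (simp add: reord_invariant_def)
  have split: "?w {\<pi> \<in> perms N. restr k \<pi> \<in> S \<and> g \<pi>} = (\<Sum>\<eta>\<in>S. ?w {\<pi>. prefixed N \<eta> \<pi> \<and> g \<pi>})" for g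
  proof -
    have len: "length \<eta> = k" if "\<eta> \<in> S" for \<eta>
      using that assms(7) permsD(3) by blast
    then have "{\<pi> \<in> perms N. restr k \<pi> \<in> S \<and> g \<pi>} = (\<Union>\<eta>\<in>S. {\<pi>. prefixed N \<eta> \<pi> \<and> g \<pi>})"
      by (auto simp: prefixed_def)
    moreover have "finite S" using finite_subset[OF assms(7)] by simp
    ultimately show ?thesis
      unfolding weight_def by (simp add: sum.UNION_disjoint len prefixed_def disjoint_iff)
  qed
  define C where "C \<eta> = \<theta> ^ c \<eta> / \<theta> ^ c ?i" for \<eta>
  have C: "?w {\<pi>. prefixed N \<eta> \<pi> \<and> g \<pi>} = C \<eta> * ?w {\<pi>. prefixed N ?i \<pi> \<and> g \<pi>}"
    if "reord_invariant N k g" "\<eta> \<in> perms k" for g \<eta>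
    using weight_reord_invariant[OF assms(1,2) that assms(5,6)] assms(1)
    by (simp add: C_def field_simps)
  have C': "?w {\<pi>. prefixed N \<eta> \<pi>} = C \<eta> * ?w {\<pi>. prefixed N ?i \<pi>}" if "\<eta> \<in> perms k" for \<eta>
    using C[OF inv_True that] by simp
  have pos: "?w {\<pi>. prefixed N ?i \<pi>} > 0" "C \<tau> > 0"
    using weight_prefixed_pos[OF assms(1) id_perm_in_perms assms(6)] assms(1) by (auto simp: C_def)
  have "?w {\<pi> \<in> perms N. restr k \<pi> \<in> S \<and> f \<pi>} = sum C S * ?w {\<pi>. prefixed N ?i \<pi> \<and> f \<pi>}"
    unfolding split sum_distrib_right using assms(3,7) by (intro sum.cong C) auto
  moreover have "?w {\<pi> \<in> perms N. restr k \<pi> \<in> S} = sum C S * ?w {\<pi>. prefixed N ?i \<pi>}"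
    using split[of "\<lambda>_. True"] assms(7) C' unfolding sum_distrib_right
    by (auto intro!: sum.cong)
  ultimately show ?thesis
    using pos C[OF assms(3,4)] C'[OF assms(4)] by (simp add: field_simps)
qed

text \<open>Presents a shorter prefix as a set of prefixes of length \<open>k\<close>, so that
  \<open>weight_invariant_proportional\<close> covers it.\<close>

lemma prefixed_iff_restr:
  assumes "\<sigma> \<in> perms m" "m \<le> k" "k \<le> N"
  shows "prefixed N \<sigma> \<pi> \<longleftrightarrow> \<pi> \<in> perms N \<and> restr k \<pi> \<in> {\<eta> \<in> perms k. restr m \<eta> = \<sigma>}"
  using assms restr_restr[OF assms(2)] restr_in_perms[OF _ assms(3)] permsD(3)[OF assms(1)]
  by (auto simp: prefixed_def)

section \<open>Comparing optimal strategies after different prefixes\<close>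

lemma rejecting_strategies_nonempty: "{} \<in> rejecting_strategies N \<sigma>"
  by (simp add: rejecting_strategies_def)

lemma finite_rejecting_strategies: "finite (rejecting_strategies N \<sigma>)"
proof -
  have "finite (prefixes N)" by (simp add: prefixes_def)
  then show ?thesis
    by (rule finite_subset[rotated, OF finite_Pow_iff[THEN iffD2]])
      (auto simp: rejecting_strategies_def)
qed

text \<open>An optimal strategy for \<open>\<tau>\<close> can be imitated after
  \<open>\<sigma>\<close>: reject the first \<open>k\<close> candidates, then act as if they had
  appeared in the relative order \<open>\<tau>\<close>.\<close>

lemma Qo_mono:
  assumes "\<theta> > 0" "prefix_equivalent N c"
    and "\<tau> \<in> perms k" "\<sigma> \<in> perms m" "1 \<le> k" "m \<le> k" "k < N"
  shows "Qo N \<theta> c \<tau> \<le> Qo N \<theta> c \<sigma>"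
proof -
  let ?w = "weight \<theta> c"
  let ?P = "\<lambda>\<sigma> A. \<P>(\<pi> in measure_pmf (interview_pmf N \<theta> c). wins N A \<pi> \<bar> prefixed N \<sigma> \<pi>)"
  note lt = permsD(3)[OF assms(3)] permsD(3)[OF assms(4)]
  have Qo: "Qo N \<theta> c \<eta> = Max (?P \<eta> ` rejecting_strategies N \<eta>)" if "length \<eta> < N" for \<eta>
    using that by (simp add: Qo_def)
  have "Qo N \<theta> c \<tau> \<in> ?P \<tau> ` rejecting_strategies N \<tau>"
    using Qo[of \<tau>] lt assms(7) finite_rejecting_strategies rejecting_strategies_nonempty
    by (metis (no_types, lifting) Max_in finite_imageI image_is_empty empty_iff)
  then obtain A where A: "A \<in> rejecting_strategies N \<tau>" "Qo N \<theta> c \<tau> = ?P \<tau> A" by auto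
  \<comment> \<open>The length condition forces rejection up to time \<open>k\<close>; afterwards
    \<open>A\<close> is consulted on the prefix it would have seen.\<close>
  define B where "B = {\<rho> \<in> prefixes N. k < length \<rho> \<and> reord \<tau> \<rho> \<in> A}"
  have B: "B \<in> rejecting_strategies N \<sigma>"
    using lt assms(6) by (auto simp: rejecting_strategies_def B_def length_restr)
  have wins: "wins N B \<pi> \<longleftrightarrow> wins N A (reord \<tau> \<pi>)" if \<pi>: "\<pi> \<in> perms N" for \<pi>
  proof -
    have len: "length \<pi> = N" using permsD[OF \<pi>] by simp
    \<comment> \<open>Neither strategy stops by time \<open>k\<close>: \<open>B\<close> by its
      length condition, and \<open>A\<close> because the rearranged order shows it exactly the
      restrictions of \<open>\<tau>\<close>.\<close>
    have low: "restr i \<pi> \<notin> B" "restr i (reord \<tau> \<pi>) \<notin> A" if "1 \<le> i" "i \<le> k" for i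
    proof -
      show "restr i \<pi> \<notin> B" using that by (simp add: B_def length_restr)
      have "restr i (reord \<tau> \<pi>) = restr i \<tau>"
        using restr_restr[OF that(2), of "reord \<tau> \<pi>"] restr_reord_eq[OF assms(3), of \<pi>]
          len assms(7) permsD[OF \<pi>] by simp
      then show "restr i (reord \<tau> \<pi>) \<notin> A"
        using A(1) that lt by (auto simp: rejecting_strategies_def)
    qed
    have high: "restr i \<pi> \<in> B \<longleftrightarrow> restr i (reord \<tau> \<pi>) \<in> A" if "k < i" "i \<le> N" for i
      using restr_reord[OF assms(3), of i \<pi>] restr_in_perms[OF \<pi>, of i] that len
      by (auto simp: B_def length_restr prefixes_def)
    have all: "restr i \<pi> \<in> B \<longleftrightarrow> restr i (reord \<tau> \<pi>) \<in> A" if "1 \<le> i" "i \<le> N" for i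
      using low[of i] high[of i] that by (cases "i \<le> k") auto
    have val: "reord \<tau> \<pi> ! (i - 1) = \<pi> ! (i - 1)" if "k < i" "i \<le> N" for i
      using that lt len by (auto simp: reord_def nth_append)
    have "restr i \<pi> \<in> B \<and> (\<forall>j\<in>{1..<i}. restr j \<pi> \<notin> B) \<and> \<pi> ! (i - 1) = N - 1 \<longleftrightarrow>
        restr i (reord \<tau> \<pi>) \<in> A \<and> (\<forall>j\<in>{1..<i}. restr j (reord \<tau> \<pi>) \<notin> A)
        \<and> reord \<tau> \<pi> ! (i - 1) = N - 1" if i: "i \<in> {1..N}" for i
    proof (cases "i \<le> k")
      case True
      then show ?thesis using low[of i] i by auto
    next
      case False
      then show ?thesis using all val[of i] i by auto
    qed
    then show ?thesis unfolding wins_def by (intro bex_cong) auto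
  qed
  \<comment> \<open>Success of \<open>B\<close> is read off from \<open>reord \<tau> \<pi>\<close>,
    which forgets the original order of the first \<open>k\<close> entries.\<close>
  have inv: "reord_invariant N k (wins N B)"
    unfolding reord_invariant_def
  proof (intro ballI)
    fix \<eta> \<pi> assume *: "\<eta> \<in> perms k" "\<pi> \<in> perms N"
    then have "reord \<tau> (reord \<eta> \<pi>) = reord \<tau> \<pi>"
      using reord_reord[OF assms(3)] permsD(3)[OF *(2)] assms(7) by simp
    then show "wins N B (reord \<eta> \<pi>) = wins N B \<pi>"
      using wins reord_in_perms[of \<eta> k N \<pi>] * assms(7) by simp
  qed
  \<comment> \<open>On a \<open>\<tau>\<close>-prefixed order the rearrangement is the identity, so
    \<open>A\<close> and \<open>B\<close> win together.\<close>
  have "{\<pi>. prefixed N \<tau> \<pi> \<and> wins N A \<pi>} = {\<pi>. prefixed N \<tau> \<pi> \<and> wins N B \<pi>}"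
    using wins reord_prefixed lt assms(7) by (auto simp: prefixed_def)
  then have "?P \<tau> A = ?w {\<pi>. prefixed N \<tau> \<pi> \<and> wins N B \<pi>} / ?w {\<pi>. prefixed N \<tau> \<pi>}"
    by (simp add: cond_prob_weight[OF assms(1)])
  also have "\<dots> = ?w {\<pi>. prefixed N \<sigma> \<pi> \<and> wins N B \<pi>} / ?w {\<pi>. prefixed N \<sigma> \<pi>}"
  proof -
    let ?S = "{\<eta> \<in> perms k. restr m \<eta> = \<sigma>}"
    have "k \<le> N" using assms(7) by simp
    note pre = prefixed_iff_restr[OF assms(4,6) this]
    have "?w {\<pi>. prefixed N \<sigma> \<pi>} > 0"
      using weight_prefixed_pos[OF assms(1,4)] assms(6,7) by simp
    then show ?thesis
      using weight_invariant_proportional[OF assms(1,2) inv assms(3,5) \<open>k \<le> N\<close>, of ?S]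
      unfolding pre conj_assoc by (simp add: field_simps)
  qed
  also have "\<dots> = ?P \<sigma> B" by (simp add: cond_prob_weight[OF assms(1)])
  also have "\<dots> \<le> Max (?P \<sigma> ` rejecting_strategies N \<sigma>)"
    using B finite_rejecting_strategies by (intro Max_ge) auto
  also have "\<dots> = Qo N \<theta> c \<sigma>" using Qo[of \<sigma>] lt assms by simp
  finally show ?thesis using A by simp
qed

section \<open>Winning as a rank event, and the comparison of prefixes\<close>

lemma reord_invariant_rank: "k \<le> N \<Longrightarrow> reord_invariant N k (\<lambda>\<pi>. sort (take k \<pi>) ! r = v)"
  using sort_take_reord[of _ k] permsD(3)[of _ N] by (auto simp: reord_invariant_def)

lemma nth_eq_sort_nth_rank:
  assumes "\<pi> \<in> perms N" "k \<le> N" "j < k"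
  shows "\<pi> ! j = sort (take k \<pi>) ! (restr k \<pi> ! j - 1)"
  using standardize_nth[of "take k \<pi>" j] permsD[OF assms(1)] assms by (simp add: restr_def)

text \<open>Separates the prefix from an invariant event: given the prefix, winning depends only on
  which value has rank \<open>r\<close> among the first \<open>k\<close>.\<close>

lemma winnable_iff_rank:
  assumes "\<tau> \<in> perms k" "1 \<le> k" "k \<le> N" "\<tau> ! (k - 1) = r"
  shows "winnable N \<tau> \<pi> \<longleftrightarrow> prefixed N \<tau> \<pi> \<and> sort (take k \<pi>) ! (r - 1) = N - 1"
  using nth_eq_sort_nth_rank[of \<pi> N k "k - 1"] permsD(3)[OF assms(1)] assms
  by (auto simp: winnable_def prefixed_def)

theorem theorem3:
  fixes N k :: nat and \<theta> :: real and c :: "nat list \<Rightarrow> nat" and \<sigma> \<tau> :: "nat list"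
  assumes "N \<ge> 1" and "\<theta> > 0"
    and "prefix_equivalent N c"
    and "type_I N \<sigma>" and "type_I N \<tau>"
    and "length \<sigma> = k - 1" and "length \<tau> = k"
    and "Qo N \<theta> c ([1..<k-1] @ [k, k-1]) \<ge> Q N \<theta> c ([1..<k-1] @ [k, k-1])"
    and "negative N \<theta> c \<tau>"
  shows "negative N \<theta> c \<sigma>"
proof -
  let ?w = "weight \<theta> c"
  define \<tau>' where "\<tau>' = [1..<k-1] @ [k, k-1]"
  have \<sigma>: "\<sigma> \<in> perms (k - 1)" "\<sigma> ! (k - 2) = k - 1" and \<tau>: "\<tau> \<in> perms k" "\<tau> ! (k - 1) = k"
    and k: "2 \<le> k" "k \<le> N"
  proof -
    obtain m m' where "\<sigma> \<in> perms m" "m \<ge> 1" "\<tau> \<in> perms m'" "m' \<le> N"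
      using assms(4,5) by (auto simp: type_I_def prefixes_def)
    moreover from this have "m = k - 1" "m' = k"
      using assms(6,7) permsD(3) by blast+
    ultimately show "\<sigma> \<in> perms (k - 1)" "\<tau> \<in> perms k" "2 \<le> k" "k \<le> N"
      by auto
    show "\<sigma> ! (k - 2) = k - 1" "\<tau> ! (k - 1) = k"
      using assms(4-7) by (auto simp: type_I_def numeral_2_eq_2)
  qed
  have \<tau>': "\<tau>' \<in> perms k" "\<tau>' ! (k - 1) = k - 1"
    using k by (auto simp: \<tau>'_def permutations_of_set_def nth_append)
  have "Q N \<theta> c \<tau> \<ge> 0"
    using assms(2) by (simp add: Q_def sum_nonneg)
  \<comment> \<open>At full length \<open>Qo\<close> is 0 by definition, so a prefix of length
    \<open>N\<close> cannot be negative.\<close>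
  then have "k < N"
    using assms(7,9) k by (cases "k = N") (auto simp: negative_def positive_def Qo_def)
  define f where "f r \<pi> \<longleftrightarrow> sort (take k \<pi>) ! (r - 1) = N - 1" for r \<pi>
  have inv: "reord_invariant N k (f r)" for r
    unfolding f_def using reord_invariant_rank k by blast
  have Q\<tau>: "Q N \<theta> c \<tau> = ?w {\<pi>. prefixed N \<tau> \<pi> \<and> f k \<pi>} / ?w {\<pi>. prefixed N \<tau> \<pi>}"
    using winnable_iff_rank[OF \<tau>(1) _ _ \<tau>(2)] k by (simp add: Q_weight f_def)
  have Q\<tau>': "Q N \<theta> c \<tau>' = ?w {\<pi>. prefixed N \<tau>' \<pi> \<and> f (k - 1) \<pi>} / ?w {\<pi>. prefixed N \<tau>' \<pi>}"
    using winnable_iff_rank[OF \<tau>'(1) _ _ \<tau>'(2)] k by (simp add: Q_weight f_def)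
  \<comment> \<open>Index \<open>k - 2\<close> is the last position of \<open>\<sigma>\<close>. In
    \<open>U\<close> its candidate has rank \<open>k\<close> among the first \<open>k\<close>, like
    the last candidate of \<open>\<tau>\<close>; in \<open>V\<close> it has rank
    \<open>k - 1\<close>, like the last candidate of \<open>\<tau>'\<close>.\<close>
  define U where "U = {\<eta> \<in> perms k. restr (k - 1) \<eta> = \<sigma> \<and> \<eta> ! (k - 2) = k}"
  define V where "V = {\<eta> \<in> perms k. restr (k - 1) \<eta> = \<sigma> \<and> \<eta> ! (k - 2) = k - 1}"
  have UV: "{\<eta> \<in> perms k. restr (k - 1) \<eta> = \<sigma>} = U \<union> V"
  proof -
    have "\<eta> ! (k - 2) = k \<or> \<eta> ! (k - 2) = k - 1"
      if "\<eta> \<in> perms k" "restr (k - 1) \<eta> = \<sigma>" for \<eta>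
    proof -
      \<comment> \<open>The last entry of \<open>\<sigma>\<close> is its maximum, so
        \<open>k - 1\<close> distinct positive values are at most \<open>\<eta> ! (k - 2)\<close>,
        which is therefore at least \<open>k - 1\<close>.\<close>
      have "k - 1 = card {y \<in> set (take (k - 1) \<eta>). y \<le> \<eta> ! (k - 2)}"
        using that \<sigma>(2) k permsD[OF that(1)] by (auto simp: restr_def standardize_def)
      also have "\<dots> \<le> card {1..\<eta> ! (k - 2)}"
        using permsD(1)[OF that(1)] by (intro card_mono) (auto dest: in_set_takeD)
      finally show ?thesis using perms_nth[OF that(1), of "k - 2"] k by auto
    qed
    then show ?thesis by (auto simp: U_def V_def)
  qed
  let ?E = "\<lambda>S. {\<pi> \<in> perms N. restr k \<pi> \<in> S}"
  have disj: "U \<inter> V = {}" using k by (auto simp: U_def V_def)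
  have pre: "{\<pi>. prefixed N \<sigma> \<pi>} = ?E U \<union> ?E V"
    using prefixed_iff_restr[OF \<sigma>(1) _ k(2)] unfolding UV by auto
  have win: "{\<pi>. winnable N \<sigma> \<pi>} = {\<pi> \<in> perms N. restr k \<pi> \<in> U \<and> f k \<pi>}
      \<union> {\<pi> \<in> perms N. restr k \<pi> \<in> V \<and> f (k - 1) \<pi>}"
  proof -
    have "\<pi> ! (k - 2) = N - 1 \<longleftrightarrow> f (restr k \<pi> ! (k - 2)) \<pi>" if "\<pi> \<in> perms N" for \<pi>
      using nth_eq_sort_nth_rank[OF that k(2), of "k - 2"] k by (simp add: f_def)
    then have "winnable N \<sigma> \<pi> \<longleftrightarrow> \<pi> \<in> ?E U \<union> ?E V \<and> f (restr k \<pi> ! (k - 2)) \<pi>" for \<pi>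
      using assms(6) unfolding pre[symmetric]
      by (auto simp: winnable_def prefixed_def numeral_2_eq_2)
    moreover have "f (\<eta> ! (k - 2)) \<pi> \<longleftrightarrow> f k \<pi>" if "\<eta> \<in> U" for \<eta> \<pi>
      using that by (simp add: U_def)
    moreover have "f (\<eta> ! (k - 2)) \<pi> \<longleftrightarrow> f (k - 1) \<pi>" if "\<eta> \<in> V" for \<eta> \<pi>
      using that by (simp add: V_def)
    ultimately show ?thesis by blast
  qed
  have addw: "?w (A \<union> B) = ?w A + ?w B" if "A \<subseteq> ?E U" "B \<subseteq> ?E V" for A B
  proof -
    have "finite A" "finite B" using that by (auto intro: finite_subset)
    then show ?thesis
      unfolding weight_def using that disj by (intro sum.union_disjoint) auto
  qed
  \<comment> \<open>On \<open>U\<close> the winning event is \<open>f k\<close>, whose conditional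
    probability is that given \<open>\<tau>\<close>; on \<open>V\<close> it is
    \<open>f (k - 1)\<close>, with that given \<open>\<tau>'\<close>.\<close>
  have "?w {\<pi>. winnable N \<sigma> \<pi>} = Q N \<theta> c \<tau> * ?w (?E U) + Q N \<theta> c \<tau>' * ?w (?E V)"
  proof -
    have "?w {\<pi>. winnable N \<sigma> \<pi>} = ?w {\<pi> \<in> perms N. restr k \<pi> \<in> U \<and> f k \<pi>}
        + ?w {\<pi> \<in> perms N. restr k \<pi> \<in> V \<and> f (k - 1) \<pi>}"
      unfolding win by (rule addw) auto
    then show ?thesis
      using weight_invariant_proportional[OF assms(2,3) inv \<tau>(1) _ k(2), of U k]
        weight_invariant_proportional[OF assms(2,3) inv \<tau>'(1) _ k(2), of V "k - 1"] k
      unfolding Q\<tau> Q\<tau>' by (simp add: U_def V_def)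
  qed
  also have "\<dots> < Qo N \<theta> c \<sigma> * ?w (?E U) + Qo N \<theta> c \<sigma> * ?w (?E V)"
  proof (rule add_less_le_mono)
    \<comment> \<open>Strictness needs \<open>U\<close> to have positive weight. Letting the next
      candidate be the smallest shifts \<open>\<sigma>\<close> up by one, so its maximum becomes
      \<open>k\<close>.\<close>
    define \<eta> where "\<eta> = map Suc \<sigma> @ [1]"
    have \<eta>: "\<eta> \<in> perms k"
    proof -
      have "Suc ` {1..k - 1} = {2..k}" using k by (simp add: image_Suc_atLeastAtMost)
      then show ?thesis
        using permsD[OF \<sigma>(1)] k by (auto simp: \<eta>_def permutations_of_set_def distinct_map)
    qed
    have "restr (k - 1) \<eta> = \<sigma>"
      using standardize_map_strict_mono[of \<sigma> Suc] standardize_perms[OF \<sigma>(1)] assms(6)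
      by (simp add: restr_def \<eta>_def)
    then have "\<eta> \<in> U"
      using \<eta> \<sigma>(2) k assms(6) by (simp add: U_def \<eta>_def nth_append)
    then have "reord \<eta> (id_perm N) \<in> ?E U"
      \<comment> \<open>Any interview order rearranged by \<open>\<eta>\<close> serves; the identity
        is simply at hand.\<close>
      using prefixed_reord[OF \<eta> k(2) id_perm_in_perms] permsD(3)[OF \<eta>] by (simp add: prefixed_def)
    then have "?w (?E U) > 0"
      using assms(2) by (intro weight_pos) auto
    moreover have "Q N \<theta> c \<tau> < Qo N \<theta> c \<sigma>"
      using Qo_mono[OF assms(2,3) \<tau>(1) \<sigma>(1) _ _ \<open>k < N\<close>] k assms(9)
      by (simp add: negative_def positive_def)
    ultimately show "Q N \<theta> c \<tau> * ?w (?E U) < Qo N \<theta> c \<sigma> * ?w (?E U)"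
      by simp
    have "Q N \<theta> c \<tau>' \<le> Qo N \<theta> c \<sigma>"
      using Qo_mono[OF assms(2,3) \<tau>'(1) \<sigma>(1) _ _ \<open>k < N\<close>] k assms(8)
      by (simp add: \<tau>'_def)
    moreover have "?w (?E V) \<ge> 0"
      using assms(2) by (simp add: weight_def sum_nonneg)
    ultimately show "Q N \<theta> c \<tau>' * ?w (?E V) \<le> Qo N \<theta> c \<sigma> * ?w (?E V)"
      by (rule mult_right_mono)
  qed
  also have "\<dots> = Qo N \<theta> c \<sigma> * ?w {\<pi>. prefixed N \<sigma> \<pi>}"
    unfolding pre by (subst addw) (auto simp: distrib_left)
  finally have "Q N \<theta> c \<sigma> < Qo N \<theta> c \<sigma>"
    using weight_prefixed_pos[OF assms(2) \<sigma>(1), of N c] k by (simp add: Q_weight field_simps)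
  then show ?thesis by (simp add: negative_def positive_def)
qed

end
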